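(* Drift-less setting, target $\rho_d=|\Psi\rangle\langle\Psi|$, neighborhoods $\mathcal N_1,\dots,\mathcal N_M$. For each $k$ let $\{\tau_{jk}\}_j$ be a basis of the real vector space of Hermitian operators of the form $X\otimes I_{\bar{\mathcal N}_k}$, and $\{\sigma_{jk}\}_j$ a basis of the real vector space (over $\mathbb R$) of all operators of the form $X\otimes I_{\bar{\mathcal N}_k}$. For real parameter vectors $\alpha=(\alpha_{jk})$, $\beta=(\beta_{jk})$ set $H_c(\alpha)=\sum_k\sum_j\alpha_{jk}\tau_{jk}$ and $D_k(\beta)=\sum_j\beta_{jk}\sigma_{jk}$, $k=1,\dots,M$. Let $V$ be the real linear subspace of parameters $(\alpha,\beta)$ such that $H_c(\alpha)|\Psi\rangle=0$ and $D_k(\beta)|\Psi\rangle=0$ for all $k$ (these are exactly the parameters for which $\rho_d$ is invariant in standard form), let $\gamma>0$ and $C$ be the cube of parameters with all entries in $[-\gamma,\gamma]$. If there exists $(\alpha,\beta)\in V$ such that $\rho_d$ is GAS for $\mathcal L(H_c(\alpha),\{D_k(\beta)\})$, then the set of $(\alpha,\beta)\in V\cap C$ for which $\rho_d$ is not GAS for $\mathcal L(H_c(\alpha),\{D_k(\beta)\})$ has zero Lebesgue measure in $V$.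
   Context: $\mathcal H=\bigotimes_{a=1}^n\mathcal H_a$ finite-dimensional; neighborhoods $\mathcal N_k\subsetneq\{1,\dots,n\}$, $I_{\bar{\mathcal N}_k}$ the identity on the complementary factors. $\mathcal L(H,\{D_k\})(\rho)=-i[H,\rho]+\sum_k(D_k\rho D_k^\dagger-\frac12\{D_k^\dagger D_k,\rho\})$. $\rho_d$ is GAS for $\mathcal L$ if $e^{\mathcal Lt}(\rho_0)\to\rho_d$ as $t\to\infty$ for every density operator $\rho_0$ on $\mathcal H$. Lebesgue measure on $V$ is taken with respect to any linear identification of $V$ with $\mathbb R^{\dim V}$. *)

theory Defs
  imports "HOL-Analysis.Analysis"
begin

text \<open>Operators on the finite-dimensional Hilbert space with orthonormal basis indexed by
  the finite type 's are complex matrices of type complex^'s^'s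
  (entry A$i$j = row i, column j).\<close>

type_synonym 's op = "complex^'s^'s"

definition adj :: "'s::finite op \<Rightarrow> 's op" where
  "adj A = (\<chi> i j. cnj (A $ j $ i))"

definition hermitian :: "'s::finite op \<Rightarrow> bool" where
  "hermitian A \<longleftrightarrow> adj A = A"

definition ctrace :: "'s::finite op \<Rightarrow> complex" where
  "ctrace A = (\<Sum>i\<in>UNIV. A $ i $ i)"

definition qform :: "'s::finite op \<Rightarrow> complex^'s \<Rightarrow> complex" where
  "qform A x = (\<Sum>i\<in>UNIV. \<Sum>j\<in>UNIV. cnj (x $ i) * A $ i $ j * x $ j)"

definition density :: "'s::finite op \<Rightarrow> bool" where
  "density A \<longleftrightarrow> hermitian A \<and> (\<forall>x. Im (qform A x) = 0 \<and> 0 \<le> Re (qform A x))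
                 \<and> ctrace A = 1"

definition cscale :: "complex \<Rightarrow> 's::finite op \<Rightarrow> 's op" where
  "cscale c A = (\<chi> i j. c * A $ i $ j)"

definition proj :: "complex^'s \<Rightarrow> 's::finite op" where
  "proj \<Psi> = (\<chi> i j. \<Psi> $ i * cnj (\<Psi> $ j))"

definition lindblad :: "'s::finite op \<Rightarrow> nat \<Rightarrow> (nat \<Rightarrow> 's op) \<Rightarrow> 's op \<Rightarrow> 's op" where
  "lindblad H M D \<rho> =
     cscale (- \<i>) (H ** \<rho> - \<rho> ** H)
     + (\<Sum>k<M. D k ** \<rho> ** adj (D k)
              - cscale (1/2) (adj (D k) ** D k ** \<rho> + \<rho> ** (adj (D k) ** D k)))"

definition semigroup :: "('s::finite op \<Rightarrow> 's op) \<Rightarrow> real \<Rightarrow> 's op \<Rightarrow> 's op" where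
  "semigroup L t \<rho> = (\<Sum>n. (t ^ n / fact n) *\<^sub>R (L ^^ n) \<rho>)"

definition GAS :: "('s::finite op \<Rightarrow> 's op) \<Rightarrow> 's op \<Rightarrow> bool" where
  "GAS L \<rho>d \<longleftrightarrow> (\<forall>\<rho>0. density \<rho>0 \<longrightarrow> ((\<lambda>t. semigroup L t \<rho>0) \<longlongrightarrow> \<rho>d) at_top)"

text \<open>Tensor-product structure: the basis state s corresponds to the configuration
  cf s :: nat => nat of local basis indices (factor a = 0..n-1 has dimension d a).
  An operator A is of the form X \<otimes> I on the complement of N iff its matrix entries are
  X(s|N, t|N) when s and t agree outside N, and 0 otherwise.\<close>
definition restr :: "(nat \<Rightarrow> nat) \<Rightarrow> nat set \<Rightarrow> nat \<Rightarrow> nat" where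
  "restr c N = (\<lambda>a. if a \<in> N then c a else 0)"

definition local_op :: "nat \<Rightarrow> ('s::finite \<Rightarrow> nat \<Rightarrow> nat) \<Rightarrow> nat set \<Rightarrow> 's op \<Rightarrow> bool" where
  "local_op n cf N A \<longleftrightarrow>
     (\<exists>X :: (nat \<Rightarrow> nat) \<Rightarrow> (nat \<Rightarrow> nat) \<Rightarrow> complex.
        \<forall>s t. A $ s $ t =
          (if \<forall>a\<in>{0..<n} - N. cf s a = cf t a
           then X (restr (cf s) N) (restr (cf t) N) else 0))"

definition tensor_basis :: "nat \<Rightarrow> (nat \<Rightarrow> nat) \<Rightarrow> ('s::finite \<Rightarrow> nat \<Rightarrow> nat) \<Rightarrow> bool" where
  "tensor_basis n d cf \<longleftrightarrow>
     bij_betw cf UNIV {c. \<forall>a. (a < n \<longrightarrow> c a < d a) \<and> (n \<le> a \<longrightarrow> c a = 0)}"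

definition real_basis_family :: "('p \<Rightarrow> 'v::real_vector) \<Rightarrow> 'p set \<Rightarrow> 'v set \<Rightarrow> bool" where
  "real_basis_family g P S \<longleftrightarrow> inj_on g P \<and> independent (g ` P) \<and> span (g ` P) = S"

text \<open>Parametrized control Hamiltonian and dissipators: parameter index p is an alpha-index
  (tau generator) if isH p, otherwise a beta-index (sigma generator); blk p is its neighbourhood k.\<close>
definition Hpar :: "('p::finite \<Rightarrow> bool) \<Rightarrow> ('p \<Rightarrow> 's::finite op) \<Rightarrow> real^'p \<Rightarrow> 's op" where
  "Hpar isH gen x = (\<Sum>p\<in>{p. isH p}. x $ p *\<^sub>R gen p)"

definition Dpar :: "('p::finite \<Rightarrow> bool) \<Rightarrow> ('p \<Rightarrow> nat) \<Rightarrow> ('p \<Rightarrow> 's::finite op) \<Rightarrow> real^'p \<Rightarrow> nat \<Rightarrow> 's op" where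
  "Dpar isH blk gen x k = (\<Sum>p\<in>{p. \<not> isH p \<and> blk p = k}. x $ p *\<^sub>R gen p)"

end

theory Submission
  imports Defs "HOL-Computational_Algebra.Polynomial"
begin

text \<open>For parameters in V the target is invariant, and the block of a state orthogonal to the target
  evolves autonomously.  The target is attractive iff the generator of that block is invertible: if it
  is, the time integral of the positive block is bounded, so its nonincreasing trace decays like 1/t;
  if it is not, a kernel element of it never decays.  Invertibility is the nonvanishing of a determinant
  polynomial in the parameters, and the zero set of a polynomial not vanishing identically is null.\<close>

subsection \<open>Zero sets of polynomials\<close>

text \<open>The determinant of the full generator is useless: the target lies in its kernel for
  every parameter in V, so it vanishes identically there. Cutting down to the orthogonal block
  removes exactly this forced kernel. No spectral theory enters. Instead of locating eigenvalues, a
  left inverse of the block generator yields a linear functional whose time derivative along a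
  trajectory is the trace of the block. Boundedness of that functional and monotonicity of that
  trace both rest on the semigroup preserving density operators, which has to be derived from its
  power series; this is the bulk of the middle of the proof. In the other direction, attraction
  speaks about density operators only, while a kernel element is an arbitrary complex matrix. It is
  split into Hermitian parts, and these are shifted into the positive cone. The parameters are real
  but the generator is complex and contains adjoints, so the polynomial finally used is the squared
  modulus of the determinant, pulled back along a linear parametrization of V.\<close>

text \<open>The point is that one bound serves all lines: it becomes the uniform multiplicity bound
  when dilated zero sets are counted. Sums take the maximum of two bounds, products their
  sum.\<close>

lemma real_polynomial_function_line_degree:
  fixes f :: "'a::real_normed_vector \<Rightarrow> real"
  assumes "real_polynomial_function f"
  shows "\<exists>D. \<forall>u w. \<exists>p. degree p \<le> D \<and> (\<forall>t. f (u + t *\<^sub>R w) = poly p t)"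
  using assms
proof (induction rule: real_polynomial_function.induct)
  case (linear f)
  interpret bounded_linear f by fact
  have "degree [:f u, f w:] \<le> 1 \<and> (\<forall>t. f (u + t *\<^sub>R w) = poly [:f u, f w:] t)" for u w
    by (auto simp: add scaleR)
  then show ?case by blast
next
  case (const c)
  have "degree [:c:] \<le> 0 \<and> (\<forall>t. c = poly [:c:] t)" by simp
  then show ?case by blast
next
  case (add f g)
  then obtain D E where
    D: "\<And>u w. \<exists>p. degree p \<le> D \<and> (\<forall>t. f (u + t *\<^sub>R w) = poly p t)" and
    E: "\<And>u w. \<exists>p. degree p \<le> E \<and> (\<forall>t. g (u + t *\<^sub>R w) = poly p t)" by blast
  have "\<exists>p. degree p \<le> max D E \<and> (\<forall>t. f (u + t *\<^sub>R w) + g (u + t *\<^sub>R w) = poly p t)" for u w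
  proof -
    obtain p q where "degree p \<le> D" "\<forall>t. f (u + t *\<^sub>R w) = poly p t"
      "degree q \<le> E" "\<forall>t. g (u + t *\<^sub>R w) = poly q t" using D E by metis
    then show ?thesis by (intro exI[of _ "p + q"]) (auto intro: degree_add_le)
  qed
  then show ?case by blast
next
  case (mult f g)
  then obtain D E where
    D: "\<And>u w. \<exists>p. degree p \<le> D \<and> (\<forall>t. f (u + t *\<^sub>R w) = poly p t)" and
    E: "\<And>u w. \<exists>p. degree p \<le> E \<and> (\<forall>t. g (u + t *\<^sub>R w) = poly p t)" by blast
  have "\<exists>p. degree p \<le> D + E \<and> (\<forall>t. f (u + t *\<^sub>R w) * g (u + t *\<^sub>R w) = poly p t)" for u w
  proof -
    obtain p q where "degree p \<le> D" "\<forall>t. f (u + t *\<^sub>R w) = poly p t"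
      "degree q \<le> E" "\<forall>t. g (u + t *\<^sub>R w) = poly q t" using D E by metis
    then show ?thesis
      by (intro exI[of _ "p * q"]) (auto intro: order.trans[OF degree_mult_le] add_mono)
  qed
  then show ?case by blast
qed

lemma continuous_on_real_polynomial_function:
  "real_polynomial_function f \<Longrightarrow> continuous_on S f"
  using continuous_on_polymonial_function real_polynomial_function_eq by blast

lemma emeasure_dilation_ge:
  fixes S :: "'a::euclidean_space set"
  assumes "S \<in> sets borel" "1 \<le> c"
  shows "emeasure lborel S \<le> emeasure lebesgue ((\<lambda>z. u + c *\<^sub>R (z - u)) ` S)"
proof -
  have "(\<lambda>z. u + c *\<^sub>R (z - u)) ` S = (\<lambda>z. c *\<^sub>R z + (u - c *\<^sub>R u)) ` S"
    by (intro image_cong) (auto simp: algebra_simps)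
  then have "emeasure lebesgue ((\<lambda>z. u + c *\<^sub>R (z - u)) ` S)
      = ennreal (\<bar>c\<bar> ^ DIM('a)) * emeasure lebesgue S"
    using emeasure_lebesgue_affine[of c "u - c *\<^sub>R u" S] by simp
  moreover have "1 \<le> ennreal (\<bar>c\<bar> ^ DIM('a))"
    using assms(2) by (simp add: one_le_power)
  then have "1 * emeasure lebesgue S \<le> ennreal (\<bar>c\<bar> ^ DIM('a)) * emeasure lebesgue S"
    by (intro mult_right_mono) auto
  ultimately show ?thesis
    using assms(1) by simp
qed

text \<open>The dilations about u of the (truncated) zero set with ratios c j cover every point at most
  D times, because f restricted to a line through u is a nonzero polynomial of degree at most D.
  As each dilation has at least the measure of the zero set, that measure must vanish.\<close>
lemma null_sets_zeros_real_polynomial_function: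
  fixes f :: "'a::euclidean_space \<Rightarrow> real"
  assumes f: "real_polynomial_function f" and u: "f u \<noteq> 0"
  shows "{x. f x = 0} \<in> null_sets lborel"
proof -
  obtain D where D: "\<And>u w. \<exists>p. degree p \<le> D \<and> (\<forall>t. f (u + t *\<^sub>R w) = poly p t)"
    using real_polynomial_function_line_degree[OF f] by blast
  define Z where "Z r = {x. f x = 0} \<inter> cball u r" for r
  have cl: "closed {x. f x = 0}"
    using continuous_closed_vimage[of "{0}" f] continuous_on_real_polynomial_function[OF f, of UNIV]
    by (simp add: vimage_def continuous_on_eq_continuous_at)
  then have Zc: "compact (Z r)" for r
    by (simp add: Z_def closed_Int_compact)
  have null: "Z r \<in> null_sets lborel" for r
  proof -
    \<comment> \<open>Any infinite supply of distinct ratios in [1, 2] would do: at least 1 so that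
      measure does not shrink, at most 2 so that all dilates stay in one ball.\<close>
    define c where "c j = 1 + 1 / real (Suc j)" for j
    define S where "S j = (\<lambda>z. u + c j *\<^sub>R (z - u)) ` Z r" for j
    have c: "1 \<le> c j" "c j \<le> 2" for j
      by (auto simp: c_def)
    have Sb: "S j \<in> sets borel" for j
      unfolding S_def
      by (intro borel_closed compact_imp_closed compact_continuous_image Zc continuous_intros)
    have sub: "S j \<subseteq> cball u (2 * r)" for j
    proof
      fix y assume "y \<in> S j"
      then obtain z where z: "y = u + c j *\<^sub>R (z - u)" "z \<in> cball u r"
        unfolding S_def Z_def by blast
      have "dist u y = c j * dist u z"
        using c[of j] by (simp add: z dist_norm norm_minus_commute)
      also have "\<dots> \<le> 2 * r"
        using c[of j] z by (intro mult_mono) auto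
      finally show "y \<in> cball u (2 * r)" by simp
    qed
    have cover: "card {j. j < k \<and> y \<in> S j} \<le> D" for k y
    proof -
      obtain p where p: "degree p \<le> D" "\<And>t. f (u + t *\<^sub>R (y - u)) = poly p t"
        using D by metis
      have "poly p 0 \<noteq> 0" using p(2)[of 0] u by simp
      then have "p \<noteq> 0" by auto
      \<comment> \<open>If y is the dilate by \<open>c j\<close> of a zero z, then z sits at
        parameter \<open>1 / c j\<close> on the line from u through y. Distinct j thus give distinct
        roots of p.\<close>
      have "inj (\<lambda>j. 1 / c j)"
        by (auto simp: inj_def c_def)
      then have "card {j. j < k \<and> y \<in> S j} = card ((\<lambda>j. 1 / c j) ` {j. j < k \<and> y \<in> S j})"
        by (intro card_image[symmetric]) (rule inj_on_subset[OF _ subset_UNIV])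
      also have "\<dots> \<le> card {t. poly p t = 0}"
      proof (intro card_mono poly_roots_finite \<open>p \<noteq> 0\<close> subsetI)
        fix t assume "t \<in> (\<lambda>j. 1 / c j) ` {j. j < k \<and> y \<in> S j}"
        then obtain j z where j: "t = 1 / c j" "y = u + c j *\<^sub>R (z - u)" "f z = 0"
          by (auto simp: S_def Z_def)
        have "u + t *\<^sub>R (y - u) = z"
          using c(1)[of j] by (simp add: j)
        then show "t \<in> {t. poly p t = 0}"
          using p(2)[of t] j by simp
      qed
      also have "\<dots> \<le> degree p"
        using \<open>p \<noteq> 0\<close> by (rule card_poly_roots_bound)
      finally show ?thesis using p by simp
    qed
    have fin: "emeasure lborel (cball u (2 * r)) < \<infinity>" "emeasure lborel (Z r) < \<infinity>"
      using emeasure_compact_finite[OF compact_cball] emeasure_compact_finite[OF Zc] by simp_all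
    \<comment> \<open>The right-hand side does not depend on k, so letting k grow forces the measure
      of \<open>Z r\<close> to be 0.\<close>
    have ineq: "real k * measure lborel (Z r) \<le> real D * measure lborel (cball u (2 * r))" for k
    proof -
      have "of_nat k * emeasure lborel (Z r) = (\<Sum>j<k. emeasure lborel (Z r))"
        by simp
      also have "\<dots> \<le> (\<Sum>j<k. emeasure lebesgue (S j))"
        unfolding S_def using c Zc
        by (intro sum_mono emeasure_dilation_ge borel_closed compact_imp_closed) auto
      also have "\<dots> = (\<Sum>j<k. \<integral>\<^sup>+ y. indicator (S j) y \<partial>lborel)"
        using Sb by (intro sum.cong) auto
      also have "\<dots> = (\<integral>\<^sup>+ y. (\<Sum>j<k. indicator (S j) y) \<partial>lborel)"
        using Sb by (subst nn_integral_sum) auto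
      also have "\<dots> \<le> (\<integral>\<^sup>+ y. of_nat D * indicator (cball u (2 * r)) y \<partial>lborel)"
      proof (rule nn_integral_mono)
        fix y
        have "(\<Sum>j<k. indicator (S j) y) = (of_nat (card {j. j < k \<and> y \<in> S j}) :: ennreal)"
          by (auto simp: indicator_def sum.If_cases Int_def intro!: arg_cong[where f=card])
        moreover have "card {j. j < k \<and> y \<in> S j} = 0" if "y \<notin> cball u (2 * r)"
          using that sub by fastforce
        ultimately show "(\<Sum>j<k. indicator (S j) y) \<le> (of_nat D * indicator (cball u (2 * r)) y :: ennreal)"
          using cover[of k y] by (cases "y \<in> cball u (2 * r)") auto
      qed
      also have "\<dots> = of_nat D * emeasure lborel (cball u (2 * r))"
        by (subst nn_integral_cmult_indicator) auto
      finally have "of_nat k * emeasure lborel (Z r) \<le> of_nat D * emeasure lborel (cball u (2 * r))" .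
      then have "ennreal (real k * measure lborel (Z r))
          \<le> ennreal (real D * measure lborel (cball u (2 * r)))"
        using fin by (simp add: emeasure_eq_ennreal_measure ennreal_mult ennreal_of_nat_eq_real_of_nat
            less_top[symmetric])
      then show ?thesis
        by (simp add: ennreal_le_iff)
    qed
    have "measure lborel (Z r) = 0"
    proof (rule ccontr)
      assume "measure lborel (Z r) \<noteq> 0"
      then have pos: "0 < measure lborel (Z r)"
        by (simp add: less_le)
      obtain k where "real D * measure lborel (cball u (2 * r)) < real k * measure lborel (Z r)"
        using reals_Archimedean3[OF pos] by blast
      with ineq[of k] show False by simp
    qed
    then have "emeasure lborel (Z r) = 0"
      using fin by (simp add: emeasure_eq_ennreal_measure less_top[symmetric])
    then show ?thesis
      using Zc[of r] by (auto intro!: null_setsI borel_closed compact_imp_closed)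
  qed
  have "{x. f x = 0} = (\<Union>r::nat. Z (real r))"
    by (auto simp: Z_def intro: real_arch_simple)
  then show ?thesis
    using null by (metis null_sets_UN)
qed

subsection \<open>Sesquilinear forms and Lindblad generators\<close>

definition sform :: "'s::finite op \<Rightarrow> complex^'s \<Rightarrow> complex^'s \<Rightarrow> complex" where
  "sform A x y = (\<Sum>i\<in>UNIV. \<Sum>j\<in>UNIV. cnj (x $ i) * A $ i $ j * y $ j)"

lemma qform_sform: "qform A x = sform A x x"
  by (simp add: qform_def sform_def)

lemma cscale_nth [simp]: "cscale c A $ i $ j = c * A $ i $ j"
  by (simp add: cscale_def)

lemma adj_nth [simp]: "adj A $ i $ j = cnj (A $ j $ i)"
  by (simp add: adj_def)

lemma scaleR_eq_cscale: "r *\<^sub>R A = cscale (of_real r) A"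
  by (auto simp: vec_eq_iff complex_eq_iff)

lemma sform_add: "sform (A + B) x y = sform A x y + sform B x y"
  and sform_diff: "sform (A - B) x y = sform A x y - sform B x y"
  by (simp_all add: sform_def sum.distrib sum_subtractf algebra_simps)

lemma sform_zero [simp]: "sform 0 x y = 0" "sform A 0 y = 0" "sform A x 0 = 0"
  by (simp_all add: sform_def)

lemma sform_cscale: "sform (cscale c A) x y = c * sform A x y"
  by (simp add: sform_def sum_distrib_left algebra_simps)

lemma sform_sum: "sform (\<Sum>k\<in>S. A k) x y = (\<Sum>k\<in>S. sform (A k) x y)"
  by (induction S rule: infinite_finite_induct) (simp_all add: sform_add)

lemma sform_add_left: "sform A (x + x') y = sform A x y + sform A x' y"
  and sform_add_right: "sform A x (y + y') = sform A x y + sform A x y'"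
  and sform_scale_left: "sform A (c *s x) y = cnj c * sform A x y"
  and sform_scale_right: "sform A x (c *s y) = c * sform A x y"
  by (simp_all add: sform_def sum.distrib sum_distrib_left algebra_simps)

lemma sform_mult_right: "sform (X ** B) x y = sform X x (B *v y)"
proof -
  have "sform (X ** B) x y =
      (\<Sum>i\<in>UNIV. \<Sum>j\<in>UNIV. \<Sum>k\<in>UNIV. cnj (x $ i) * X $ i $ k * B $ k $ j * y $ j)"
    by (simp add: sform_def matrix_matrix_mult_def sum_distrib_left sum_distrib_right mult.assoc)
  also have "\<dots> = (\<Sum>i\<in>UNIV. \<Sum>k\<in>UNIV. \<Sum>j\<in>UNIV. cnj (x $ i) * X $ i $ k * B $ k $ j * y $ j)"
    by (intro sum.cong refl sum.swap)
  also have "\<dots> = sform X x (B *v y)"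
    by (simp add: sform_def matrix_vector_mult_def sum_distrib_left mult.assoc)
  finally show ?thesis .
qed

lemma sform_axis: "sform A (axis i 1) (axis j 1) = A $ i $ j"
proof -
  have "sform A (axis i 1) (axis j 1) =
     (\<Sum>i'\<in>UNIV. \<Sum>j'\<in>UNIV. if i' = i \<and> j' = j then A $ i' $ j' else 0)"
    unfolding sform_def by (intro sum.cong refl) (auto simp: axis_def)
  also have "\<dots> = (\<Sum>i'\<in>UNIV. if i' = i then A $ i' $ j else 0)"
    by (intro sum.cong refl) auto
  finally show ?thesis by simp
qed

lemma adj_adj [simp]: "adj (adj A) = A"
  and adj_add: "adj (A + B) = adj A + adj B"
  and adj_diff: "adj (A - B) = adj A - adj B"
  and adj_cscale: "adj (cscale c A) = cscale (cnj c) (adj A)"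
  and adj_scaleR: "adj (r *\<^sub>R A) = r *\<^sub>R adj A"
  and adj_zero [simp]: "adj 0 = 0"
  and adj_one [simp]: "adj (mat 1) = mat 1"
  by (auto simp: vec_eq_iff mat_def)

lemma adj_sum: "adj (\<Sum>k\<in>S. A k) = (\<Sum>k\<in>S. adj (A k))"
  by (induction S rule: infinite_finite_induct) (simp_all add: adj_add)

lemma adj_mult: "adj (A ** B) = adj B ** adj A"
  by (simp add: vec_eq_iff matrix_matrix_mult_def mult.commute)

lemma linear_adj: "linear adj"
  by (intro linearI adj_add adj_scaleR)

lemma sform_adj: "sform (adj A) x y = cnj (sform A y x)"
  unfolding sform_def by (subst sum.swap) (simp add: algebra_simps)

lemma sform_mult_left: "sform (A ** X) x y = sform X (adj A *v x) y"
proof -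
  have "sform (A ** X) x y = cnj (sform (adj X ** adj A) y x)"
    by (simp flip: sform_adj add: adj_mult)
  also have "\<dots> = sform X (adj A *v x) y"
    by (simp add: sform_mult_right flip: sform_adj)
  finally show ?thesis .
qed

lemma Im_qform_hermitian: "hermitian A \<Longrightarrow> Im (qform A x) = 0"
  using sform_adj[of A x x] by (simp add: hermitian_def qform_sform complex_eq_iff)

lemma cscale_add: "cscale c (A + B) = cscale c A + cscale c B"
  and cscale_diff: "cscale c (A - B) = cscale c A - cscale c B"
  and cscale_cscale: "cscale c (cscale d A) = cscale (c * d) A"
  and cscale_mult_left: "cscale c A ** B = cscale c (A ** B)"
  and cscale_mult_right: "A ** cscale c B = cscale c (A ** B)"
  and cscale_zero [simp]: "cscale c 0 = 0"
  by (simp_all add: vec_eq_iff matrix_matrix_mult_def sum_distrib_left algebra_simps)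

lemma cscale_sum: "cscale c (\<Sum>k\<in>S. A k) = (\<Sum>k\<in>S. cscale c (A k))"
  by (induction S rule: infinite_finite_induct) (simp_all add: cscale_add)

lemma matrix_diff_rdistrib: "((A::'s::finite op) - B) ** C = A ** C - B ** C"
  and matrix_diff_ldistrib: "(C::'s::finite op) ** (A - B) = C ** A - C ** B"
  by (simp_all add: vec_eq_iff matrix_matrix_mult_def sum_subtractf algebra_simps)

lemma matrix_add_rdistrib: "((A::complex^'m^'n) + B) ** C = A ** C + B ** C"
  by (simp add: vec_eq_iff matrix_matrix_mult_def sum.distrib algebra_simps)

lemma lindblad_add: "lindblad H M D (X + Y) = lindblad H M D X + lindblad H M D Y"
  unfolding lindblad_def matrix_add_ldistrib matrix_add_rdistrib cscale_add cscale_diff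
    sum.distrib sum_subtractf by simp

lemma lindblad_cscale: "lindblad H M D (cscale c X) = cscale c (lindblad H M D X)"
  by (simp add: lindblad_def cscale_mult_left cscale_mult_right cscale_add cscale_diff
      cscale_sum cscale_cscale mult.commute)

lemma linear_lindblad: "linear (lindblad H M D)"
  by (intro linearI lindblad_add) (simp add: scaleR_eq_cscale lindblad_cscale)

lemma lindblad_adj:
  assumes "hermitian H"
  shows "lindblad H M D (adj X) = adj (lindblad H M D X)"
proof -
  have H: "adj H = H" using assms by (simp add: hermitian_def)
  have "cscale (- \<i>) (H ** adj X - adj X ** H) = adj (cscale (- \<i>) (H ** X - X ** H))"
    unfolding adj_cscale adj_diff adj_mult H by (simp add: vec_eq_iff algebra_simps)
  moreover have "D k ** adj X ** adj (D k) - cscale (1/2) (adj (D k) ** D k ** adj X + adj X ** (adj (D k) ** D k))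
     = adj (D k ** X ** adj (D k) - cscale (1/2) (adj (D k) ** D k ** X + X ** (adj (D k) ** D k)))" for k
    unfolding adj_cscale adj_diff adj_add adj_mult adj_adj matrix_mul_assoc by (simp add: add.commute)
  ultimately show ?thesis
    unfolding lindblad_def adj_add adj_sum by (simp only:)
qed

lemma ctrace_trace: "ctrace = trace"
  by (simp add: fun_eq_iff ctrace_def trace_def)

lemma ctrace_zero [simp]: "ctrace 0 = 0"
  by (simp add: ctrace_def)

lemma ctrace_add: "ctrace (A + B) = ctrace A + ctrace B"
  and ctrace_diff: "ctrace (A - B) = ctrace A - ctrace B"
  and ctrace_cscale: "ctrace (cscale c A) = c * ctrace A"
  and ctrace_scaleR: "ctrace (r *\<^sub>R A) = r *\<^sub>R ctrace A"
  by (simp_all add: ctrace_def sum.distrib sum_subtractf sum_distrib_left scaleR_sum_right)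

lemma ctrace_sum: "ctrace (\<Sum>k\<in>S. A k) = (\<Sum>k\<in>S. ctrace (A k))"
  by (induction S rule: infinite_finite_induct) (simp_all add: ctrace_add ctrace_zero)

lemma ctrace_commute: "ctrace (A ** B) = ctrace (B ** A)"
  unfolding ctrace_trace by (rule trace_mul_sym)

lemma ctrace_lindblad: "ctrace (lindblad H M D X) = 0"
proof -
  have "ctrace (D k ** X ** adj (D k)) = ctrace (adj (D k) ** D k ** X)" for k
    using ctrace_commute[of "D k ** X" "adj (D k)"] by (simp add: matrix_mul_assoc)
  moreover have "ctrace (X ** (adj (D k) ** D k)) = ctrace (adj (D k) ** D k ** X)" for k
    by (rule ctrace_commute)
  ultimately show ?thesis
    by (simp add: lindblad_def ctrace_add ctrace_diff ctrace_cscale ctrace_sum ctrace_commute[of X H])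
qed

text \<open>All factors are moved from the matrix onto the vectors. Terms then vanish visibly when H
  and D k annihilate a vector, or when X does; the jump terms remain.\<close>

lemma sform_lindblad:
  assumes "hermitian H"
  shows "sform (lindblad H M D X) x y = - \<i> * (sform X (H *v x) y - sform X x (H *v y))
     + (\<Sum>k<M. sform X (adj (D k) *v x) (adj (D k) *v y)
        - (sform X (adj (D k) *v (D k *v x)) y + sform X x (adj (D k) *v (D k *v y))) / 2)"
  using assms
  by (simp add: lindblad_def sform_add sform_diff sform_cscale sform_sum sform_mult_left[where X = X]
      sform_mult_right[where X = X] sform_mult_right[where X = "A ** X" for A] hermitian_def adj_mult matrix_vector_mul_assoc)

subsection \<open>The semigroup and preservation of positivity\<close>

lemma norm_funpow_le:
  fixes L :: "'v::real_normed_vector \<Rightarrow> 'v"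
  assumes "\<And>x. norm (L x) \<le> B * norm x" "0 \<le> B"
  shows "norm ((L ^^ n) x) \<le> B ^ n * norm x"
proof (induction n)
  case (Suc n)
  have "norm (L ((L ^^ n) x)) \<le> B * norm ((L ^^ n) x)" by (rule assms)
  also have "\<dots> \<le> B * (B ^ n * norm x)" by (intro mult_left_mono Suc assms)
  finally show ?case by (simp add: mult.assoc)
qed simp

lemma summable_semigroup:
  fixes L :: "'s::finite op \<Rightarrow> 's op"
  assumes "linear L"
  shows "summable (\<lambda>n. (t ^ n / fact n) *\<^sub>R (L ^^ n) X)"
proof -
  obtain B where B: "0 \<le> B" "\<And>x. norm (L x) \<le> B * norm x"
    using bounded_linear.nonneg_bounded[of L] assms
    by (auto simp: linear_conv_bounded_linear mult.commute)
  show ?thesis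
  proof (rule summable_comparison_test')
    show "summable (\<lambda>n. (inverse (fact n) * (\<bar>t\<bar> * B) ^ n) * norm X)"
      by (intro summable_mult2 summable_exp)
    show "norm ((t ^ n / fact n) *\<^sub>R (L ^^ n) X) \<le> (inverse (fact n) * (\<bar>t\<bar> * B) ^ n) * norm X"
      if "n \<ge> 0" for n
    proof -
      have "norm ((t ^ n / fact n) *\<^sub>R (L ^^ n) X) = \<bar>t\<bar> ^ n / fact n * norm ((L ^^ n) X)"
        by (simp add: power_abs)
      also have "\<dots> \<le> \<bar>t\<bar> ^ n / fact n * (B ^ n * norm X)"
        by (intro mult_left_mono norm_funpow_le B) simp
      finally show ?thesis
        by (simp add: power_mult_distrib field_simps)
    qed
  qed
qed

lemma linear_funpow: "linear L \<Longrightarrow> linear (L ^^ n)" for L :: "'v::real_vector \<Rightarrow> 'v"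
  by (induction n) (simp_all add: linear_compose linear_id)

lemma semigroup_functional:
  fixes L :: "'s::finite op \<Rightarrow> 's op" and f :: "'s op \<Rightarrow> 'b::real_normed_vector"
  assumes "linear L" "linear f"
  shows "f (semigroup L t X) = (\<Sum>n. (t ^ n / fact n) *\<^sub>R f ((L ^^ n) X))"
    and "summable (\<lambda>n. (t ^ n / fact n) *\<^sub>R f ((L ^^ n) X))"
proof -
  interpret f: bounded_linear f using assms by (simp add: linear_conv_bounded_linear)
  show "f (semigroup L t X) = (\<Sum>n. (t ^ n / fact n) *\<^sub>R f ((L ^^ n) X))"
    unfolding semigroup_def using f.suminf[OF summable_semigroup[OF assms(1)], of t X]
    by (simp add: f.scaleR)
  show "summable (\<lambda>n. (t ^ n / fact n) *\<^sub>R f ((L ^^ n) X))"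
    using f.summable[OF summable_semigroup[OF assms(1)], of t X] by (simp add: f.scaleR)
qed

lemma semigroup_commute:
  fixes L :: "'s::finite op \<Rightarrow> 's op"
  assumes "linear L" "linear T" "\<And>X. T (L X) = L (T X)"
  shows "T (semigroup L t X) = semigroup L t (T X)"
proof -
  have "T ((L ^^ n) X) = (L ^^ n) (T X)" for n
    by (induction n) (simp_all add: assms(3))
  then show ?thesis
    using semigroup_functional(1)[OF assms(1,2)] by (simp add: semigroup_def)
qed

text \<open>Only the term n = 0 of the series survives. It serves both for conservation of the trace
  and for a kernel element of the block.\<close>

lemma semigroup_fixed:
  fixes L :: "'s::finite op \<Rightarrow> 's op" and f :: "'s op \<Rightarrow> 'b::real_normed_vector"
  assumes "linear L" "linear f" "\<And>n. f ((L ^^ Suc n) X) = 0"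
  shows "f (semigroup L t X) = f X"
proof -
  have "f ((L ^^ n) X) = 0" if "n \<notin> {0}" for n
    using that assms(3)[of "n - 1"] by simp
  then show ?thesis
    unfolding semigroup_functional(1)[OF assms(1,2)] by (subst suminf_finite[of "{0}"]) auto
qed

lemma semigroup_0 [simp]: "semigroup L 0 X = X"
  unfolding semigroup_def by (subst suminf_finite[of "{0}"]) auto

lemma linear_semigroup:
  fixes L :: "'s::finite op \<Rightarrow> 's op"
  assumes "linear L"
  shows "linear (semigroup L t)"
proof
  show "semigroup L t (X + Y) = semigroup L t X + semigroup L t Y" for X Y
    unfolding semigroup_def
    by (subst suminf_add) (simp_all add: summable_semigroup assms linear_add[OF linear_funpow] scaleR_add_right)
  show "semigroup L t (r *\<^sub>R X) = r *\<^sub>R semigroup L t X" for r X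
    by (rule semigroup_commute[symmetric]) (auto simp: assms linear_cmul linear_scaleR)
qed

text \<open>Composing with a real functional reduces the matter to a scalar power series; termwise
  differentiation shifts the index, which amounts to inserting one more L.\<close>

lemma DERIV_semigroup:
  fixes L :: "'s::finite op \<Rightarrow> 's op" and f :: "'s op \<Rightarrow> real"
  assumes "linear L" "linear f"
  shows "((\<lambda>t. f (semigroup L t X)) has_real_derivative f (L (semigroup L t X))) (at t)"
proof -
  define c where "c n = f ((L ^^ n) X) / fact n" for n
  have eq: "(t ^ n / fact n) *\<^sub>R f ((L ^^ n) X) = c n * t ^ n" for n t
    by (simp add: c_def)
  have "((\<lambda>t. \<Sum>n. c n * t ^ n) has_field_derivative (\<Sum>n. diffs c n * t ^ n)) (at t)"
    using semigroup_functional(2)[OF assms, of _ X]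
    by (intro termdiffs_strong_converges_everywhere) (simp only: eq)
  moreover have "(\<lambda>t. \<Sum>n. c n * t ^ n) = (\<lambda>t. f (semigroup L t X))"
    unfolding semigroup_functional(1)[OF assms] by (simp only: eq)
  moreover have "(\<Sum>n. diffs c n * t ^ n) = f (L (semigroup L t X))"
  proof -
    have "f (L (semigroup L t X)) = (\<Sum>n. (t ^ n / fact n) *\<^sub>R f (L ((L ^^ n) X)))"
      using semigroup_functional(1)[OF assms(1) linear_compose[OF assms], of t X] by simp
    moreover have "(t ^ n / fact n) *\<^sub>R f (L ((L ^^ n) X)) = diffs c n * t ^ n" for n
      by (simp add: c_def diffs_def)
    ultimately show ?thesis by (simp only:)
  qed
  ultimately show ?thesis by (simp only:)
qed

lemma continuous_on_semigroup:
  fixes L :: "'s::finite op \<Rightarrow> 's op"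
  assumes "linear L"
  shows "continuous_on A (\<lambda>t. semigroup L t X)"
proof (subst continuous_on_componentwise, intro ballI)
  fix b :: "'s op"
  have "linear (\<lambda>Y. Y \<bullet> b)" by (simp add: bounded_linear.linear bounded_linear_inner_left)
  then show "continuous_on A (\<lambda>t. semigroup L t X \<bullet> b)"
    by (intro DERIV_continuous_on[OF DERIV_subset[OF DERIV_semigroup[OF assms]]]) auto
qed

section \<open>Positive semidefinite matrices\<close>

definition psd :: "'s::finite op \<Rightarrow> bool" where
  "psd A \<longleftrightarrow> hermitian A \<and> (\<forall>x. 0 \<le> Re (qform A x))"

lemma density_iff_psd: "density A \<longleftrightarrow> psd A \<and> ctrace A = 1"
  by (auto simp: density_def psd_def Im_qform_hermitian)

lemma qform_scale: "qform A (c *s x) = of_real ((cmod c)\<^sup>2) * qform A x"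
  unfolding qform_sform sform_scale_left sform_scale_right complex_norm_square by simp

text \<open>The form is homogeneous of degree two. Passing to the unit sphere makes compactness
  available later.\<close>

lemma psdI_unit:
  assumes "hermitian A" "\<And>x. norm x = 1 \<Longrightarrow> 0 \<le> Re (qform A x)"
  shows "psd A"
  unfolding psd_def
proof (intro conjI allI assms(1))
  fix x
  show "0 \<le> Re (qform A x)"
  proof (cases "x = 0")
    case False
    define u where "u = inverse (norm x) *\<^sub>R x"
    have "norm u = 1" using False by (simp add: u_def)
    moreover have "x = of_real (norm x) *s u"
      using False by (auto simp: u_def vec_eq_iff complex_eq_iff)
    then have "Re (qform A x) = (norm x)\<^sup>2 * Re (qform A u)"
      using qform_scale[of A "of_real (norm x)" u] by (simp flip: of_real_power)
    ultimately show ?thesis using assms(2) by simp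
  qed (simp add: qform_sform)
qed

lemma psd_Cauchy_Schwarz:
  assumes "psd A"
  shows "(cmod (sform A x y))\<^sup>2 \<le> Re (qform A x) * Re (qform A y)"
proof -
  define a b s where "a = Re (qform A x)" and "b = Re (qform A y)" and "s = sform A x y"
  define S where "S = (cmod s)\<^sup>2"
  have yx: "sform A y x = cnj s"
    using assms sform_adj[of A y x] by (simp add: psd_def hermitian_def s_def)
  have expand: "qform A (x + c *s y) = qform A x + c * s + cnj c * cnj s + c * cnj c * qform A y" for c
    unfolding qform_sform sform_add_left sform_add_right sform_scale_left sform_scale_right yx
    by (simp add: s_def algebra_simps)
  \<comment> \<open>The coefficient c = - r * cnj s makes both cross terms equal to the real number
    - r * S, leaving a real quadratic in r.\<close>
  have ineq: "0 \<le> a - 2 * r * S + r\<^sup>2 * S * b" for r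
  proof -
    have "qform A (x + (- of_real r * cnj s) *s y)
        = qform A x - 2 * of_real r * (s * cnj s) + of_real (r\<^sup>2) * (s * cnj s) * qform A y"
      unfolding expand by (simp add: algebra_simps power2_eq_square)
    then have "Re (qform A (x + (- of_real r * cnj s) *s y)) = a - 2 * r * S + r\<^sup>2 * S * b"
      unfolding complex_norm_square[symmetric]
      by (simp add: a_def b_def S_def flip: of_real_power)
    with assms show ?thesis by (metis psd_def)
  qed
  have nn: "0 \<le> a" "0 \<le> b" "0 \<le> S" using assms by (auto simp: psd_def a_def b_def S_def)
  show ?thesis
  proof (cases "b = 0")
    case True
    have "S = 0"
    proof (rule ccontr)
      assume "S \<noteq> 0"
      \<comment> \<open>For b = 0 the quadratic is affine in r; this r gives it the value
        -1.\<close>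
      then show False using ineq[of "(a + 1) / (2 * S)"] True nn by simp
    qed
    then show ?thesis using True nn by (simp add: S_def s_def b_def[symmetric])
  next
    case False
    \<comment> \<open>r = 1 / b minimizes the quadratic, with minimum a - S / b.\<close>
    then have "S \<le> a * b"
      using ineq[of "1 / b"] nn by (simp add: field_simps power2_eq_square)
    then show ?thesis by (simp add: S_def s_def a_def b_def)
  qed
qed

lemma sform_eq_0_psd:
  assumes "psd A" "qform A x = 0"
  shows "sform A x y = 0" "sform A y x = 0"
  using psd_Cauchy_Schwarz[OF assms(1), of x y] psd_Cauchy_Schwarz[OF assms(1), of y x] assms(2)
  by auto

lemma norm_op_power2: "(norm A)\<^sup>2 = (\<Sum>i\<in>UNIV. \<Sum>j\<in>UNIV. (cmod (A $ i $ j))\<^sup>2)"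
  for A :: "'s::finite op"
  by (simp add: norm_vec_def L2_set_def sum_nonneg)

text \<open>Cauchy-Schwarz at basis vectors bounds each squared entry by the product of two diagonal
  entries, and these products sum to the squared trace.\<close>

lemma norm_density_le:
  assumes "density A"
  shows "norm A \<le> 1"
proof -
  have psd: "psd A" and tr: "ctrace A = 1" using assms by (auto simp: density_iff_psd)
  have "(norm A)\<^sup>2 \<le> (\<Sum>i\<in>UNIV. \<Sum>j\<in>UNIV. Re (A $ i $ i) * Re (A $ j $ j))"
    unfolding norm_op_power2 using psd_Cauchy_Schwarz[OF psd, of "axis _ 1" "axis _ 1"]
    by (intro sum_mono) (simp add: qform_sform sform_axis)
  also have "\<dots> = (Re (ctrace A))\<^sup>2"
    by (simp add: ctrace_def power2_eq_square sum_product)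
  finally show ?thesis using tr by (simp add: power2_le_iff_abs_le abs_square_le_1)
qed

lemma qform_one: "qform (mat 1) x = of_real ((norm x)\<^sup>2)"
proof -
  have "qform (mat 1) x = (\<Sum>i\<in>UNIV. \<Sum>j\<in>UNIV. if i = j then cnj (x $ i) * x $ i else 0)"
    unfolding qform_def by (intro sum.cong refl) (auto simp: mat_def)
  also have "\<dots> = (\<Sum>i\<in>UNIV. cnj (x $ i) * x $ i)"
    by simp
  also have "\<dots> = of_real ((norm x)\<^sup>2)"
    unfolding norm_vec_def L2_set_def
    by (simp add: sum_nonneg complex_norm_square mult.commute del: of_real_power)
  finally show ?thesis .
qed

lemma cmod_qform_le:
  assumes "norm x = 1"
  shows "cmod (qform A x) \<le> (\<Sum>i\<in>UNIV. \<Sum>j\<in>UNIV. cmod (A $ i $ j))"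
  unfolding qform_def
proof (intro sum_norm_le)
  fix i j
  have "cmod (x $ i) \<le> 1" "cmod (x $ j) \<le> 1"
    using Finite_Cartesian_Product.norm_nth_le[of x] assms by metis+
  then have "cmod (x $ i) * cmod (A $ i $ j) * cmod (x $ j) \<le> 1 * cmod (A $ i $ j) * 1"
    by (intro mult_mono) auto
  then show "cmod (cnj (x $ i) * A $ i $ j * x $ j) \<le> cmod (A $ i $ j)"
    by (simp add: norm_mult)
qed

lemma linear_Re_sform: "linear (\<lambda>A. Re (sform A x y))"
  by (intro linearI) (simp_all add: sform_add scaleR_eq_cscale sform_cscale)

lemma linear_Re_qform: "linear (\<lambda>A. Re (qform A x))"
  unfolding qform_sform by (rule linear_Re_sform)

lemma hermitian_semigroup_lindblad:
  "hermitian H \<Longrightarrow> hermitian X \<Longrightarrow> hermitian (semigroup (lindblad H M D) t X)"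
  using semigroup_commute[OF linear_lindblad linear_adj, of H M D t X]
  by (metis hermitian_def lindblad_adj)

text \<open>A psd matrix cannot leave the cone through x: the negative part of the generator only
  involves A x = 0.\<close>
lemma Re_qform_lindblad_ge_0:
  assumes "hermitian H" "psd A" "qform A x = 0"
  shows "0 \<le> Re (qform (lindblad H M D A) x)"
  using assms unfolding qform_sform sform_lindblad[OF assms(1)]
  by (auto simp: sform_eq_0_psd[OF assms(2,3)] Re_sum psd_def simp flip: qform_sform intro!: sum_nonneg)

lemma qform_add_one: "norm x = 1 \<Longrightarrow> qform (A + r *\<^sub>R mat 1) x = qform A x + of_real r"
  by (simp add: qform_sform sform_add scaleR_eq_cscale sform_cscale)
     (simp add: qform_one flip: qform_sform)

lemma hermitian_add_one: "hermitian A \<Longrightarrow> hermitian (A + r *\<^sub>R mat 1)"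
  by (simp add: hermitian_def adj_add adj_scaleR)

text \<open>First-exit argument. At the earliest time s when the shifted form reaches 0 at some unit
  z, the shifted matrix is psd and annihilates z, so the generator cannot push it outwards there.
  Because c strictly exceeds the effect of L on the identity, the growing shift turns this into a
  strictly positive derivative. The form was then negative just before s, contradicting minimality.
  Without the shift the derivative would only be nonnegative.\<close>

lemma Re_qform_semigroup_gt:
  assumes H: "hermitian H" and X: "psd X" and \<epsilon>: "0 < \<epsilon>" and t: "0 \<le> t" and x: "norm x = 1"
    and c: "\<And>z. norm z = 1 \<Longrightarrow> cmod (qform (lindblad H M D (mat 1)) z) < c"
  shows "0 < Re (qform (semigroup (lindblad H M D) t X) x) + \<epsilon> * exp (c * t)"
proof (rule ccontr)
  assume neg: "\<not> 0 < Re (qform (semigroup (lindblad H M D) t X) x) + \<epsilon> * exp (c * t)"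
  define L where "L = lindblad H M D"
  define y where "y t = semigroup L t X" for t
  define g where "g s z = Re (qform (y s) z) + \<epsilon> * exp (c * s)" for s z
  have L: "linear L" by (simp add: L_def linear_lindblad)
  have der: "((\<lambda>s. g s z) has_real_derivative Re (qform (L (y s)) z) + \<epsilon> * (c * exp (c * s))) (at s)" for s z
    unfolding g_def y_def
    by (rule derivative_eq_intros DERIV_semigroup[OF L linear_Re_qform] refl | simp)+
  have y_cont: "continuous_on UNIV y"
    unfolding y_def[abs_def] by (rule continuous_on_semigroup[OF L])
  \<comment> \<open>The violations up to time t form a compact set, so an earliest one
    exists.\<close>
  define B where "B = {p \<in> {0..t} \<times> sphere 0 1. g (fst p) (snd p) \<le> 0}"
  have "continuous_on UNIV (\<lambda>p. g (fst p) (snd p))"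
    unfolding g_def qform_def
    by (intro continuous_intros continuous_on_compose2[OF y_cont]) auto
  then have "closed {p. g (fst p) (snd p) \<le> 0}"
    by (intro closed_Collect_le) auto
  then have "compact (({0..t} \<times> sphere 0 1) \<inter> {p. g (fst p) (snd p) \<le> 0})"
    by (intro compact_Int_closed compact_Times compact_Icc compact_sphere)
  then have "compact B"
    by (simp add: B_def Collect_conj_eq)
  moreover have "(t, x) \<in> B"
    using neg t x by (auto simp: B_def g_def y_def L_def not_less)
  ultimately obtain p where p: "p \<in> B" "\<And>q. q \<in> B \<Longrightarrow> fst p \<le> fst q"
    using continuous_attains_inf[of B fst] continuous_on_fst[OF continuous_on_id, of B] by blast
  obtain s z where sz: "p = (s, z)" by (cases p)
  have s: "0 \<le> s" "s \<le> t" and z: "norm z = 1" and gsz: "g s z \<le> 0"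
    using p(1) by (auto simp: B_def sz)
  have before: "0 < g r w" if "0 \<le> r" "r < s" "norm w = 1" for r w
    using p(2)[of "(r, w)"] that s by (force simp: B_def sz)
  have "g 0 z > 0"
    using X \<epsilon> by (simp add: g_def y_def psd_def add_nonneg_pos)
  with gsz have "s \<noteq> 0" by auto
  with s have "0 < s" by simp
  \<comment> \<open>Positivity before s passes to s by left continuity, for all unit vectors and not
    only for z; this makes the shifted matrix psd.\<close>
  have at_s: "0 \<le> g s w" if "norm w = 1" for w
  proof (rule tendsto_lowerbound)
    have "isCont (\<lambda>r. g r w) s" using der DERIV_isCont by blast
    then show "((\<lambda>r. g r w) \<longlongrightarrow> g s w) (at_left s)"
      by (simp add: isCont_def filterlim_at_split)
    show "\<forall>\<^sub>F r in at_left s. 0 \<le> g r w"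
      using eventually_at_left_real[OF \<open>0 < s\<close>]
      by eventually_elim (use before that in \<open>auto intro: less_imp_le\<close>)
  qed simp
  define \<sigma> where "\<sigma> = y s + (\<epsilon> * exp (c * s)) *\<^sub>R mat 1"
  have \<sigma>: "Re (qform \<sigma> w) = g s w" if "norm w = 1" for w
    using that by (simp add: \<sigma>_def g_def qform_add_one)
  have "hermitian (y s)"
    using X H unfolding y_def L_def by (intro hermitian_semigroup_lindblad) (auto simp: psd_def)
  then have "psd \<sigma>"
    using at_s \<sigma> by (intro psdI_unit) (auto simp: \<sigma>_def hermitian_add_one)
  moreover have "qform \<sigma> z = 0"
    using \<sigma>[OF z] gsz at_s[OF z] Im_qform_hermitian[of \<sigma> z] \<open>psd \<sigma>\<close>
    by (auto simp: complex_eq_iff psd_def)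
  ultimately have "0 \<le> Re (qform (L \<sigma>) z)"
    unfolding L_def by (rule Re_qform_lindblad_ge_0[OF H])
  also have "Re (qform (L \<sigma>) z) = Re (qform (L (y s)) z) + \<epsilon> * exp (c * s) * Re (qform (L (mat 1)) z)"
    unfolding \<sigma>_def linear_add[OF L] linear_cmul[OF L]
    using linear_add[OF linear_Re_qform] linear_cmul[OF linear_Re_qform] by (metis real_scaleR_def)
  also have "\<dots> < Re (qform (L (y s)) z) + \<epsilon> * exp (c * s) * c"
    using c[OF z] complex_Re_le_cmod[of "qform (L (mat 1)) z"] \<epsilon> by (auto simp: L_def)
  finally have "0 < Re (qform (L (y s)) z) + \<epsilon> * (c * exp (c * s))" by (simp add: algebra_simps)
  from DERIV_pos_inc_left[OF der this]
  obtain d where d: "0 < d" "\<And>h. 0 < h \<Longrightarrow> h < d \<Longrightarrow> g (s - h) z < g s z" by auto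
  define h where "h = min s d / 2"
  have "0 < h" "h < d" "h < s" using d \<open>0 < s\<close> by (auto simp: h_def)
  then show False
    using d(2)[of h] before[of "s - h" z] z gsz by simp
qed

lemma psd_semigroup_lindblad:
  assumes H: "hermitian H" and X: "psd X" and t: "0 \<le> t"
  shows "psd (semigroup (lindblad H M D) t X)"
proof (rule psdI_unit)
  show "hermitian (semigroup (lindblad H M D) t X)"
    using X H by (intro hermitian_semigroup_lindblad) (auto simp: psd_def)
next
  fix x :: "complex^'a" assume x: "norm x = 1"
  \<comment> \<open>The summand 1 makes the bound on the sphere strict.\<close>
  define c where "c = (\<Sum>i\<in>UNIV. \<Sum>j\<in>UNIV. cmod (lindblad H M D (mat 1) $ i $ j)) + 1"
  have c: "cmod (qform (lindblad H M D (mat 1)) z) < c" if "norm z = 1" for z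
    using cmod_qform_le[OF that, of "lindblad H M D (mat 1)"] by (simp add: c_def)
  show "0 \<le> Re (qform (semigroup (lindblad H M D) t X) x)"
  proof (rule field_le_epsilon)
    fix e :: real assume "0 < e"
    then show "0 \<le> Re (qform (semigroup (lindblad H M D) t X) x) + e"
      \<comment> \<open>Dividing by the exponential cancels the growth of the shift at the fixed
        time t, leaving an arbitrary e.\<close>
      using Re_qform_semigroup_gt[OF H X _ t x c, of "e / exp (c * t)"] by simp
  qed
qed

lemma ctrace_semigroup_lindblad: "ctrace (semigroup (lindblad H M D) t X) = ctrace X"
proof (rule semigroup_fixed)
  show "linear ctrace" by (intro linearI) (simp_all add: ctrace_add ctrace_scaleR)
qed (simp_all add: linear_lindblad ctrace_lindblad)

lemma density_semigroup_lindblad: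
  "hermitian H \<Longrightarrow> density X \<Longrightarrow> 0 \<le> t \<Longrightarrow> density (semigroup (lindblad H M D) t X)"
  by (simp add: density_iff_psd psd_semigroup_lindblad ctrace_semigroup_lindblad)

subsection \<open>The block orthogonal to the target\<close>

lemma adj_proj: "adj (proj \<Psi>) = proj \<Psi>"
  by (simp add: vec_eq_iff proj_def)

lemma mult_proj_eq_0: "A *v \<Psi> = 0 \<Longrightarrow> A ** proj \<Psi> = 0"
  by (simp add: vec_eq_iff proj_def matrix_matrix_mult_def matrix_vector_mult_def
      mult.assoc[symmetric] sum_distrib_right[symmetric])

lemma ctrace_proj_mult: "ctrace (proj \<Psi> ** X) = qform X \<Psi>"
  unfolding ctrace_def qform_def matrix_matrix_mult_def proj_def
  by (subst sum.swap) (simp add: algebra_simps)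

lemma proj_mult_proj:
  assumes "norm \<Psi> = 1"
  shows "proj \<Psi> ** proj \<Psi> = proj \<Psi>"
proof -
  have "(\<Sum>k\<in>UNIV. \<Psi> $ k * cnj (\<Psi> $ k)) = of_real ((norm \<Psi>)\<^sup>2)"
    unfolding norm_vec_def L2_set_def
    by (simp add: sum_nonneg complex_norm_square del: of_real_power)
  then have one: "(\<Sum>k\<in>UNIV. \<Psi> $ k * cnj (\<Psi> $ k)) = 1"
    using assms by simp
  have "(\<Sum>k\<in>UNIV. \<Psi> $ i * cnj (\<Psi> $ k) * (\<Psi> $ k * cnj (\<Psi> $ j)))
      = \<Psi> $ i * (\<Sum>k\<in>UNIV. \<Psi> $ k * cnj (\<Psi> $ k)) * cnj (\<Psi> $ j)" for i j
    unfolding sum_distrib_left sum_distrib_right by (intro sum.cong refl) simp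
  then show ?thesis
    by (simp add: vec_eq_iff proj_def matrix_matrix_mult_def one)
qed

text \<open>For unit \<Psi> this is the block on the orthogonal complement of \<Psi>, kept as a
  full-size matrix so that no type for the smaller space is needed.\<close>

definition compress :: "complex^'s \<Rightarrow> 's::finite op \<Rightarrow> 's op" where
  "compress \<Psi> X = (mat 1 - proj \<Psi>) ** X ** (mat 1 - proj \<Psi>)"

lemma compress_add: "compress \<Psi> (X + Y) = compress \<Psi> X + compress \<Psi> Y"
  and compress_diff: "compress \<Psi> (X - Y) = compress \<Psi> X - compress \<Psi> Y"
  and compress_cscale: "compress \<Psi> (cscale c X) = cscale c (compress \<Psi> X)"
  and compress_zero [simp]: "compress \<Psi> 0 = 0"
  unfolding compress_def matrix_add_ldistrib matrix_add_rdistrib matrix_diff_ldistrib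
    matrix_diff_rdistrib cscale_mult_left cscale_mult_right by (simp_all add: cscale_diff)

lemma compress_sum: "compress \<Psi> (\<Sum>k\<in>S. A k) = (\<Sum>k\<in>S. compress \<Psi> (A k))"
  by (induction S rule: infinite_finite_induct) (simp_all add: compress_add)

lemma compress_adj: "compress \<Psi> (adj X) = adj (compress \<Psi> X)"
  by (simp add: compress_def adj_mult adj_diff adj_proj matrix_mul_assoc)

lemma linear_compress: "linear (compress \<Psi>)"
  by (intro linearI compress_add) (simp add: scaleR_eq_cscale compress_cscale)

context
  fixes \<Psi> :: "complex^'s::finite"
  assumes unit: "norm \<Psi> = 1"
begin

lemma proj_compl_idem: "(mat 1 - proj \<Psi>) ** (mat 1 - proj \<Psi>) = mat 1 - proj \<Psi>"
  unfolding matrix_diff_ldistrib matrix_diff_rdistrib by (simp add: proj_mult_proj unit)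

lemma compress_compress [simp]: "compress \<Psi> (compress \<Psi> X) = compress \<Psi> X"
  unfolding compress_def by (metis proj_compl_idem matrix_mul_assoc)

lemma compress_proj [simp]: "compress \<Psi> (proj \<Psi>) = 0"
  by (simp add: compress_def matrix_diff_rdistrib proj_mult_proj unit)

text \<open>For a density operator this is the weight outside the target, one minus the
  fidelity.\<close>

lemma ctrace_compress: "ctrace (compress \<Psi> X) = ctrace X - qform X \<Psi>"
proof -
  have "ctrace (compress \<Psi> X) = ctrace ((mat 1 - proj \<Psi>) ** ((mat 1 - proj \<Psi>) ** X))"
    unfolding compress_def by (rule ctrace_commute)
  also have "\<dots> = ctrace ((mat 1 - proj \<Psi>) ** X)"
    by (simp add: matrix_mul_assoc proj_compl_idem)
  finally show ?thesis
    by (simp add: matrix_diff_rdistrib ctrace_diff ctrace_proj_mult)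
qed

text \<open>Expanding the square, both squared norms are at most 1 and the real inner product with
  the target is the fidelity. Convergence is thereby reduced to one scalar.\<close>

lemma norm_diff_proj_le:
  assumes "density A"
  shows "(norm (A - proj \<Psi>))\<^sup>2 \<le> 2 * (1 - Re (qform A \<Psi>))"
proof -
  have "A \<bullet> proj \<Psi> = Re (qform A \<Psi>)"
    by (simp add: inner_vec_def proj_def qform_def inner_complex_def algebra_simps sum.distrib)
  moreover have "(norm (proj \<Psi>))\<^sup>2 = 1"
  proof -
    have "(norm (proj \<Psi>))\<^sup>2 = (\<Sum>i\<in>UNIV. (cmod (\<Psi> $ i))\<^sup>2) * (\<Sum>i\<in>UNIV. (cmod (\<Psi> $ i))\<^sup>2)"
      by (simp add: norm_op_power2 proj_def norm_mult power_mult_distrib sum_product)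
    also have "(\<Sum>i\<in>UNIV. (cmod (\<Psi> $ i))\<^sup>2) = 1"
      using unit by (simp add: norm_vec_def L2_set_def)
    finally show ?thesis by simp
  qed
  moreover have "(norm A)\<^sup>2 \<le> 1"
    using norm_density_le[OF assms] by (simp add: power_le_one)
  ultimately show ?thesis
    by (simp add: power2_norm_eq_inner inner_diff_left inner_diff_right inner_commute)
qed

end

text \<open>Injectivity of this map amounts to invertibility of the generator induced on the block
  orthogonal to the target; the second summand makes the map trivial on the remaining blocks.\<close>
definition block_gen ::
    "complex^'s \<Rightarrow> 's::finite op \<Rightarrow> nat \<Rightarrow> (nat \<Rightarrow> 's op) \<Rightarrow> 's op \<Rightarrow> 's op" where
  "block_gen \<Psi> H M D X = compress \<Psi> (lindblad H M D (compress \<Psi> X)) - (X - compress \<Psi> X)"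

lemma block_gen_add: "block_gen \<Psi> H M D (X + Y) = block_gen \<Psi> H M D X + block_gen \<Psi> H M D Y"
  and block_gen_cscale: "block_gen \<Psi> H M D (cscale c X) = cscale c (block_gen \<Psi> H M D X)"
  by (simp_all add: block_gen_def compress_add compress_cscale lindblad_add lindblad_cscale cscale_diff)

lemma block_gen_sum: "block_gen \<Psi> H M D (\<Sum>k\<in>S. A k) = (\<Sum>k\<in>S. block_gen \<Psi> H M D (A k))"
proof (induction S rule: infinite_finite_induct)
  case empty
  show ?case using block_gen_cscale[of \<Psi> H M D 0 0] by (simp add: vec_eq_iff)
next
  case (infinite S)
  then show ?case using block_gen_cscale[of \<Psi> H M D 0 0] by (simp add: vec_eq_iff)
qed (simp add: block_gen_add)

lemma linear_block_gen: "linear (block_gen \<Psi> H M D)"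
  by (intro linearI block_gen_add) (simp add: scaleR_eq_cscale block_gen_cscale)

lemma block_gen_adj: "hermitian H \<Longrightarrow> block_gen \<Psi> H M D (adj X) = adj (block_gen \<Psi> H M D X)"
  by (simp add: block_gen_def compress_adj lindblad_adj adj_diff)

section \<open>Attraction for Hermitian initial data\<close>

lemma Im_ctrace_hermitian: "hermitian A \<Longrightarrow> Im (ctrace A) = 0"
  using Im_qform_hermitian[of A "axis _ 1"]
  by (simp add: ctrace_def Im_sum qform_sform sform_axis)

lemma Re_ctrace_psd_nonneg: "psd A \<Longrightarrow> 0 \<le> Re (ctrace A)"
proof -
  assume "psd A"
  then have "0 \<le> Re (A $ i $ i)" for i
    unfolding psd_def by (metis qform_sform sform_axis)
  then show ?thesis by (simp add: ctrace_def Re_sum sum_nonneg)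
qed

lemma density_normalize:
  assumes "psd A" "0 < Re (ctrace A)"
  shows "density ((1 / Re (ctrace A)) *\<^sub>R A)"
  unfolding density_iff_psd psd_def
proof (intro conjI allI)
  show "hermitian ((1 / Re (ctrace A)) *\<^sub>R A)"
    using assms by (simp add: psd_def hermitian_def adj_scaleR)
  show "0 \<le> Re (qform ((1 / Re (ctrace A)) *\<^sub>R A) x)" for x
    using assms linear_cmul[OF linear_Re_qform, of "1 / Re (ctrace A)" A x] by (simp add: psd_def)
  show "ctrace ((1 / Re (ctrace A)) *\<^sub>R A) = 1"
    using assms Im_ctrace_hermitian[of A] by (simp add: ctrace_scaleR psd_def complex_eq_iff)
qed

lemma GAS_tendsto_psd:
  assumes L: "linear L" and gas: "GAS L \<rho>d" and A: "psd A" "0 < Re (ctrace A)"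
  shows "((\<lambda>t. semigroup L t A) \<longlongrightarrow> Re (ctrace A) *\<^sub>R \<rho>d) at_top"
proof -
  let ?r = "Re (ctrace A)"
  have "((\<lambda>t. ?r *\<^sub>R semigroup L t ((1 / ?r) *\<^sub>R A)) \<longlongrightarrow> ?r *\<^sub>R \<rho>d) at_top"
    using gas density_normalize[OF A] by (intro tendsto_intros) (auto simp: GAS_def)
  moreover have "?r *\<^sub>R semigroup L t ((1 / ?r) *\<^sub>R A) = semigroup L t A" for t
    using A(2) by (simp add: linear_cmul[OF linear_semigroup[OF L]])
  ultimately show ?thesis by simp
qed

lemma psd_one: "psd (mat 1)"
  by (auto simp: psd_def hermitian_def qform_one simp flip: of_real_power)

lemma psd_add: "psd A \<Longrightarrow> psd B \<Longrightarrow> psd (A + B)"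
  by (auto simp: psd_def hermitian_def adj_add qform_sform sform_add)

lemma Re_ctrace_one_pos: "0 < Re (ctrace (mat 1 :: 's::finite op))"
  by (simp add: ctrace_def mat_def)

text \<open>A Hermitian matrix is a difference of two positive ones, here X plus a multiple of the
  identity and that multiple. Each converges to a multiple of the target.\<close>

lemma GAS_tendsto_hermitian:
  assumes L: "linear L" and gas: "GAS L \<rho>d" and X: "hermitian X"
  shows "\<exists>c. ((\<lambda>t. semigroup L t X) \<longlongrightarrow> c *\<^sub>R \<rho>d) at_top"
proof -
  define c where "c = (\<Sum>i\<in>UNIV. \<Sum>j\<in>UNIV. cmod (X $ i $ j))"
  have "psd (X + c *\<^sub>R mat 1)"
  proof (rule psdI_unit)
    fix x :: "complex^'a" assume x: "norm x = 1"
    show "0 \<le> Re (qform (X + c *\<^sub>R mat 1) x)"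
      using cmod_qform_le[OF x, of X] abs_Re_le_cmod[of "qform X x"]
      by (simp add: qform_add_one x c_def)
  qed (simp add: hermitian_add_one X)
  \<comment> \<open>The second copy of the identity keeps the trace strictly positive; for X = 0 the
    first shift is zero.\<close>
  then have psd: "psd (X + c *\<^sub>R mat 1 + mat 1)" "0 < Re (ctrace (X + c *\<^sub>R mat 1 + mat 1))"
    using Re_ctrace_psd_nonneg[of "X + c *\<^sub>R mat 1"] Re_ctrace_one_pos[where 's='a]
    by (auto intro: psd_add psd_one simp: ctrace_add)
  let ?A = "X + c *\<^sub>R mat 1 + mat 1"
  have "((\<lambda>t. semigroup L t ?A - (c + 1) *\<^sub>R semigroup L t (mat 1)) \<longlongrightarrow>
      Re (ctrace ?A) *\<^sub>R \<rho>d - (c + 1) *\<^sub>R (Re (ctrace (mat 1 :: 'a op)) *\<^sub>R \<rho>d)) at_top"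
    by (rule tendsto_diff[OF GAS_tendsto_psd[OF L gas psd]
          tendsto_scaleR[OF tendsto_const GAS_tendsto_psd[OF L gas psd_one Re_ctrace_one_pos]]])
  moreover have "semigroup L t ?A - (c + 1) *\<^sub>R semigroup L t (mat 1) = semigroup L t X" for t
  proof -
    interpret linear "semigroup L t" by (rule linear_semigroup[OF L])
    show ?thesis by (simp add: add scaleR algebra_simps)
  qed
  ultimately show ?thesis
    by (auto simp: scaleR_left.diff[symmetric])
qed

text \<open>Membership in V with the parametrization stripped off.\<close>

locale invariant_pure_state =
  fixes \<Psi> :: "complex^'s::finite" and H :: "'s op" and M :: nat and D :: "nat \<Rightarrow> 's op"
  assumes unit: "norm \<Psi> = 1" and herm: "hermitian H"
    and H\<Psi>: "H *v \<Psi> = 0" and D\<Psi>: "\<And>k. k < M \<Longrightarrow> D k *v \<Psi> = 0"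
begin

abbreviation "L \<equiv> lindblad H M D"
abbreviation "P \<equiv> mat 1 - proj \<Psi>"

text \<open>This is autonomy of the block. As H and D k annihilate \<Psi>, the projection P is
  absorbed by H on both sides, by D k on its right and by its adjoint on the left. D k may still map
  into \<Psi>, so weight can leave the block but none enters it.\<close>

lemma compress_L: "compress \<Psi> (L (compress \<Psi> X)) = compress \<Psi> (L X)"
proof -
  have right: "A ** P = A" if "A *v \<Psi> = 0" for A :: "'s op"
    by (simp add: matrix_diff_ldistrib mult_proj_eq_0[OF that])
  have left: "P ** adj A = adj A" if "A *v \<Psi> = 0" for A
    using arg_cong[OF right[OF that], of adj] by (simp add: adj_mult adj_diff adj_proj)
  have right': "B ** A ** P = B ** A" if "A *v \<Psi> = 0" for A B :: "'s op"
    by (simp add: right[OF that] flip: matrix_mul_assoc)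
  have left': "B ** P ** adj A = B ** adj A" if "A *v \<Psi> = 0" for A B :: "'s op"
    by (simp add: left[OF that] flip: matrix_mul_assoc)
  have P: "B ** P ** P = B ** P" for B :: "'s op"
    by (simp add: proj_compl_idem[OF unit] flip: matrix_mul_assoc)
  have H: "H ** P = H" "P ** H = H" "B ** P ** H = B ** H" "B ** H ** P = B ** H" for B :: "'s op"
    using right[OF H\<Psi>] left[OF H\<Psi>] left'[OF H\<Psi>] right'[OF H\<Psi>] herm by (simp_all add: hermitian_def)
  have "compress \<Psi> (cscale (- \<i>) (H ** compress \<Psi> X - compress \<Psi> X ** H))
      = compress \<Psi> (cscale (- \<i>) (H ** X - X ** H))"
    unfolding compress_cscale compress_diff by (simp add: compress_def matrix_mul_assoc H P proj_compl_idem[OF unit])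
  moreover have "compress \<Psi> (D k ** compress \<Psi> X ** adj (D k)
         - cscale (1/2) (adj (D k) ** D k ** compress \<Psi> X + compress \<Psi> X ** (adj (D k) ** D k)))
      = compress \<Psi> (D k ** X ** adj (D k)
         - cscale (1/2) (adj (D k) ** D k ** X + X ** (adj (D k) ** D k)))" if "k < M" for k
    using D\<Psi>[OF that] unfolding compress_cscale compress_diff compress_add
    by (simp add: compress_def matrix_mul_assoc
        right right' left left' P proj_compl_idem[OF unit])
  ultimately show ?thesis
    unfolding lindblad_def by (simp add: compress_add compress_sum)
qed

lemma block_gen_compress: "block_gen \<Psi> H M D (compress \<Psi> X) = compress \<Psi> (L X)"
  by (simp add: block_gen_def compress_L unit)

text \<open>Only the jump terms survive at \<Psi>, so the fidelity never decreases.\<close>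

lemma Re_qform_L_target_nonneg:
  assumes "psd A"
  shows "0 \<le> Re (qform (L A) \<Psi>)"
proof -
  have "qform (L A) \<Psi> = (\<Sum>k<M. qform A (adj (D k) *v \<Psi>))"
    unfolding qform_sform sform_lindblad[OF herm] by (simp add: H\<Psi> D\<Psi>)
  then show ?thesis
    using assms by (simp add: psd_def Re_sum sum_nonneg)
qed

text \<open>With g a left inverse of the block generator, the trace of g applied to the block is a
  bounded antiderivative of the trace of the block; since that trace is nonincreasing, it is O(1/t).\<close>
lemma GAS_if_inj_block_gen:
  assumes inj: "\<And>X. block_gen \<Psi> H M D X = 0 \<Longrightarrow> X = 0"
  shows "GAS L (proj \<Psi>)"
  unfolding GAS_def
proof (intro allI impI)
  fix \<rho> :: "'s op" assume \<rho>: "density \<rho>"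
  define y where "y t = semigroup L t \<rho>" for t
  define v where "v t = 1 - Re (qform (y t) \<Psi>)" for t
  have dens: "density (y t)" if "0 \<le> t" for t
    unfolding y_def by (rule density_semigroup_lindblad[OF herm \<rho> that])
  have "inj (block_gen \<Psi> H M D)"
    using inj linear_injective_0[OF linear_block_gen] by blast
  then obtain g where g: "linear g" "g \<circ> block_gen \<Psi> H M D = id"
    using linear_injective_left_inverse[OF linear_block_gen] by blast
  define T where "T X = Re (ctrace (g (compress \<Psi> X)))" for X
  have T: "linear T"
    unfolding T_def using g(1)
    by (intro linearI) (simp_all add: linear_add[OF linear_compress] linear_cmul[OF linear_compress]
        linear_add[OF g(1)] linear_cmul[OF g(1)] ctrace_add ctrace_scaleR)
  obtain B where B: "0 \<le> B" "\<And>X. \<bar>T X\<bar> \<le> B * norm X"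
    using bounded_linear.nonneg_bounded[of T] T
    by (auto simp: linear_conv_bounded_linear mult.commute)
  have TB: "\<bar>T (y t)\<bar> \<le> B" if "0 \<le> t" for t
    using B(2)[of "y t"] mult_left_mono[OF norm_density_le[OF dens[OF that]] B(1)] by simp
  have TL: "T (L (y t)) = v t" for t
  proof -
    have "g (compress \<Psi> (L (y t))) = compress \<Psi> (y t)"
      using g(2) by (simp add: fun_eq_iff flip: block_gen_compress)
    then show ?thesis
      using \<rho> by (simp add: T_def v_def y_def ctrace_compress[OF unit] ctrace_semigroup_lindblad density_def)
  qed
  have anti: "v t \<le> v s" if "0 \<le> s" "s \<le> t" for s t
  proof -
    have "Re (qform (y s) \<Psi>) \<le> Re (qform (y t) \<Psi>)"
    proof (rule DERIV_nonneg_imp_nondecreasing[OF that(2)])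
      fix r assume "s \<le> r"
      then have "0 \<le> Re (qform (L (y r)) \<Psi>)"
        using dens[of r] that(1) by (intro Re_qform_L_target_nonneg) (simp add: density_iff_psd)
      then show "\<exists>d. ((\<lambda>r. Re (qform (y r) \<Psi>)) has_real_derivative d) (at r) \<and> 0 \<le> d"
        unfolding y_def using DERIV_semigroup[OF linear_lindblad linear_Re_qform] by blast
    qed
    then show ?thesis by (simp add: v_def)
  qed
  have v: "v t \<le> 2 * B / t" if "0 < t" for t
  proof -
    have der: "((\<lambda>t. T (y t)) has_real_derivative v s) (at s)" for s
      unfolding TL[symmetric] y_def by (rule DERIV_semigroup[OF linear_lindblad T])
    \<comment> \<open>The increment of T equals t times an intermediate value of v, which dominates
      \<open>v t\<close> by monotonicity; the increment is at most 2 * B.\<close>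
    obtain r where r: "0 < r" "r < t" "T (y t) - T (y 0) = (t - 0) * v r"
      using MVT2[OF \<open>0 < t\<close>, of "\<lambda>t. T (y t)" v, OF der] by blast
    have "t * v t \<le> t * v r"
      using r that by (intro mult_left_mono anti) auto
    also have "\<dots> \<le> 2 * B"
      using r TB[of t] TB[of 0] that by simp
    finally show ?thesis using that by (simp add: field_simps)
  qed
  have "((\<lambda>t. norm (y t - proj \<Psi>)) \<longlongrightarrow> 0) at_top"
  proof (rule tendsto_sandwich[of "\<lambda>_. 0" _ _ "\<lambda>t. sqrt (4 * B / t)"])
    have "((\<lambda>t. sqrt (4 * B / t)) \<longlongrightarrow> sqrt 0) at_top"
      by (intro tendsto_real_sqrt tendsto_divide_0[OF tendsto_const] filterlim_at_top_imp_at_infinity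
          filterlim_ident)
    then show "((\<lambda>t. sqrt (4 * B / t)) \<longlongrightarrow> 0) at_top" by simp
    show "\<forall>\<^sub>F t in at_top. norm (y t - proj \<Psi>) \<le> sqrt (4 * B / t)"
      using eventually_gt_at_top[of 0]
    proof eventually_elim
      case (elim t)
      then have "(norm (y t - proj \<Psi>))\<^sup>2 \<le> 4 * B / t"
        using norm_diff_proj_le[OF unit dens[of t]] v[of t] by (simp add: v_def)
      then show ?case by (rule real_le_rsqrt)
    qed
  qed auto
  then show "((\<lambda>t. semigroup L t \<rho>) \<longlongrightarrow> proj \<Psi>) at_top"
    unfolding y_def by (rule LIM_zero_cancel[OF tendsto_norm_zero_cancel])
qed

text \<open>The two summands of \<open>block_gen\<close> lie in complementary blocks and vanish
  separately: X is its own block, and L X has block 0. By autonomy the block of the evolved X stays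
  X, while attraction drives it to a multiple of the block of the target, which is 0.\<close>

lemma block_gen_hermitian_eq_0:
  assumes gas: "GAS L (proj \<Psi>)" and X: "hermitian X" "block_gen \<Psi> H M D X = 0"
  shows "X = 0"
proof -
  have "compress \<Psi> (block_gen \<Psi> H M D X) = compress \<Psi> (L X)"
    by (simp add: block_gen_def compress_diff compress_L unit)
  with X have LX: "compress \<Psi> (L X) = 0" by simp
  with X have cX: "compress \<Psi> X = X"
    by (simp add: block_gen_def compress_L)
  have "compress \<Psi> ((L ^^ Suc n) X) = 0" for n
  proof (induction n)
    case (Suc n)
    have "compress \<Psi> ((L ^^ Suc (Suc n)) X) = compress \<Psi> (L (compress \<Psi> ((L ^^ Suc n) X)))"
      by (simp add: compress_L)
    then show ?case
      unfolding Suc by (simp add: linear_0[OF linear_lindblad])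
  qed (simp add: LX)
  then have const: "compress \<Psi> (semigroup L t X) = X" for t
    using semigroup_fixed[OF linear_lindblad linear_compress] cX by metis
  obtain c where "((\<lambda>t. semigroup L t X) \<longlongrightarrow> c *\<^sub>R proj \<Psi>) at_top"
    using GAS_tendsto_hermitian[OF linear_lindblad gas X(1)] by blast
  then have "((\<lambda>t. compress \<Psi> (semigroup L t X)) \<longlongrightarrow> compress \<Psi> (c *\<^sub>R proj \<Psi>)) at_top"
    by (rule bounded_linear.tendsto[OF linear_conv_bounded_linear[THEN iffD1, OF linear_compress]])
  then have "((\<lambda>t::real. X) \<longlongrightarrow> 0) at_top"
    by (simp add: const linear_cmul[OF linear_compress] unit)
  then show "X = 0"
    by (simp add: tendsto_const_iff)
qed

lemma GAS_iff_inj_block_gen: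
  "GAS L (proj \<Psi>) \<longleftrightarrow> (\<forall>X. block_gen \<Psi> H M D X = 0 \<longrightarrow> X = 0)"
proof
  assume gas: "GAS L (proj \<Psi>)"
  show "\<forall>X. block_gen \<Psi> H M D X = 0 \<longrightarrow> X = 0"
  proof (intro allI impI)
    fix X assume X: "block_gen \<Psi> H M D X = 0"
    \<comment> \<open>X + adj X and i (X - adj X) are Hermitian and again in the kernel, by complex
      linearity and compatibility with adjoints; together they determine X.\<close>
    then have X': "block_gen \<Psi> H M D (adj X) = 0"
      by (simp add: block_gen_adj[OF herm])
    have s1: "X + adj X = 0"
    proof (rule block_gen_hermitian_eq_0[OF gas])
      show "hermitian (X + adj X)" by (simp add: hermitian_def adj_add add.commute)
      show "block_gen \<Psi> H M D (X + adj X) = 0" by (simp add: block_gen_add X X')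
    qed
    have s2: "cscale \<i> X + cscale (- \<i>) (adj X) = 0"
    proof (rule block_gen_hermitian_eq_0[OF gas])
      show "hermitian (cscale \<i> X + cscale (- \<i>) (adj X))"
        by (simp add: hermitian_def adj_add adj_cscale add.commute)
      show "block_gen \<Psi> H M D (cscale \<i> X + cscale (- \<i>) (adj X)) = 0"
        by (simp add: block_gen_add block_gen_cscale X X')
    qed
    have "X $ i $ j = 0" for i j
    proof -
      have "cnj (X $ j $ i) = X $ i $ j"
        using arg_cong[OF s2, of "\<lambda>A. A $ i $ j"] by simp
      then show ?thesis
        using arg_cong[OF s1, of "\<lambda>A. A $ i $ j"] by (simp flip: mult_2)
    qed
    then show "X = 0" by (simp add: vec_eq_iff)
  qed
qed (use GAS_if_inj_block_gen in blast)

end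

subsection \<open>The determinant as a polynomial in the parameters\<close>

text \<open>The variables are real, so conjugation preserves this class; that admits the adjoints in
  the generator.\<close>

definition complex_polynomial_function :: "('a::real_normed_vector \<Rightarrow> complex) \<Rightarrow> bool" where
  "complex_polynomial_function f \<longleftrightarrow>
     real_polynomial_function (\<lambda>x. Re (f x)) \<and> real_polynomial_function (\<lambda>x. Im (f x))"

lemma complex_polynomial_function_const: "complex_polynomial_function (\<lambda>x. c)"
  by (auto simp: complex_polynomial_function_def)

lemma complex_polynomial_function_add:
  "complex_polynomial_function f \<Longrightarrow> complex_polynomial_function g
    \<Longrightarrow> complex_polynomial_function (\<lambda>x. f x + g x)"
  by (auto simp: complex_polynomial_function_def)

lemma complex_polynomial_function_diff:
  "complex_polynomial_function f \<Longrightarrow> complex_polynomial_function g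
    \<Longrightarrow> complex_polynomial_function (\<lambda>x. f x - g x)"
  by (auto simp: complex_polynomial_function_def)

lemma complex_polynomial_function_mult:
  "complex_polynomial_function f \<Longrightarrow> complex_polynomial_function g
    \<Longrightarrow> complex_polynomial_function (\<lambda>x. f x * g x)"
  by (auto simp: complex_polynomial_function_def)

lemma complex_polynomial_function_cnj:
  "complex_polynomial_function f \<Longrightarrow> complex_polynomial_function (\<lambda>x. cnj (f x))"
  by (auto simp: complex_polynomial_function_def)

lemma complex_polynomial_function_sum:
  "(\<And>i. i \<in> S \<Longrightarrow> complex_polynomial_function (\<lambda>x. f x i))
    \<Longrightarrow> complex_polynomial_function (\<lambda>x. \<Sum>i\<in>S. f x i)"
  by (induction S rule: infinite_finite_induct)
     (simp_all add: complex_polynomial_function_const complex_polynomial_function_add)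

lemma complex_polynomial_function_prod:
  "(\<And>i. i \<in> S \<Longrightarrow> complex_polynomial_function (\<lambda>x. f x i))
    \<Longrightarrow> complex_polynomial_function (\<lambda>x. \<Prod>i\<in>S. f x i)"
  by (induction S rule: infinite_finite_induct)
     (simp_all add: complex_polynomial_function_const complex_polynomial_function_mult)

lemma complex_polynomial_function_det:
  fixes A :: "'a::real_normed_vector \<Rightarrow> complex^'n::finite^'n"
  assumes "\<And>i j. complex_polynomial_function (\<lambda>x. A x $ i $ j)"
  shows "complex_polynomial_function (\<lambda>x. det (A x))"
  unfolding det_def
  by (intro complex_polynomial_function_sum complex_polynomial_function_mult
      complex_polynomial_function_const complex_polynomial_function_prod assms)

lemma real_polynomial_function_cmod_power2:
  "complex_polynomial_function f \<Longrightarrow> real_polynomial_function (\<lambda>x. (cmod (f x))\<^sup>2)"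
  by (auto simp: complex_polynomial_function_def cmod_power2)

definition op_polynomial_function :: "('a::real_normed_vector \<Rightarrow> 's::finite op) \<Rightarrow> bool" where
  "op_polynomial_function F \<longleftrightarrow> (\<forall>i j. complex_polynomial_function (\<lambda>x. F x $ i $ j))"

lemma op_polynomial_function_linear:
  fixes F :: "'a::euclidean_space \<Rightarrow> 's::finite op"
  assumes "linear F"
  shows "op_polynomial_function F"
proof -
  have "linear (\<lambda>x. Re (F x $ i $ j))" "linear (\<lambda>x. Im (F x $ i $ j))" for i j
    by (auto intro!: linearI simp: linear_add[OF assms] linear_cmul[OF assms])
  then show ?thesis
    by (auto simp: op_polynomial_function_def complex_polynomial_function_def linear_conv_bounded_linear)
qed

lemma op_polynomial_function_intros:
  fixes F G :: "'a::real_normed_vector \<Rightarrow> 's::finite op"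
  shows "op_polynomial_function (\<lambda>x. A :: 's op)"
    and "op_polynomial_function F \<Longrightarrow> op_polynomial_function G \<Longrightarrow> op_polynomial_function (\<lambda>x. F x + G x)"
    and "op_polynomial_function F \<Longrightarrow> op_polynomial_function G \<Longrightarrow> op_polynomial_function (\<lambda>x. F x - G x)"
    and "op_polynomial_function F \<Longrightarrow> op_polynomial_function G \<Longrightarrow> op_polynomial_function (\<lambda>x. F x ** G x)"
    and "op_polynomial_function F \<Longrightarrow> op_polynomial_function (\<lambda>x. cscale c (F x))"
    and "op_polynomial_function F \<Longrightarrow> op_polynomial_function (\<lambda>x. adj (F x))"
  by (auto simp: op_polynomial_function_def matrix_matrix_mult_def intro!:
      complex_polynomial_function_const complex_polynomial_function_add complex_polynomial_function_diff
      complex_polynomial_function_mult complex_polynomial_function_cnj complex_polynomial_function_sum)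

lemma op_polynomial_function_sum:
  "(\<And>k. k \<in> S \<Longrightarrow> op_polynomial_function (\<lambda>x. F x k)) \<Longrightarrow> op_polynomial_function (\<lambda>x. \<Sum>k\<in>S. F x k)"
  by (induction S rule: infinite_finite_induct) (simp_all add: op_polynomial_function_intros)

lemma op_polynomial_function_block_gen:
  assumes "op_polynomial_function H" "\<And>k. op_polynomial_function (\<lambda>x. D x k)"
  shows "op_polynomial_function (\<lambda>x. block_gen \<Psi> (H x) M (D x) X)"
  unfolding block_gen_def compress_def lindblad_def
  by (intro op_polynomial_function_intros op_polynomial_function_sum assms)

definition unit_op :: "'s \<times> 's \<Rightarrow> 's::finite op" where
  "unit_op q = (\<chi> i j. if q = (i, j) then 1 else 0)"

text \<open>Determinant of the complex-linear map \<open>block_gen\<close> in the basis of matrix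
  units, indexed by pairs.\<close>

definition block_det :: "complex^'s \<Rightarrow> 's::finite op \<Rightarrow> nat \<Rightarrow> (nat \<Rightarrow> 's op) \<Rightarrow> complex" where
  "block_det \<Psi> H M D =
     det ((\<chi> p q. block_gen \<Psi> H M D (unit_op q) $ fst p $ snd p) :: complex^('s \<times> 's)^('s \<times> 's))"

lemma op_eq_sum_unit_op:
  "(\<chi> i j. x $ (i, j)) = (\<Sum>q\<in>UNIV. cscale (x $ q) (unit_op q))"
proof -
  have "x $ (i, j) = (\<Sum>q\<in>UNIV. if q = (i, j) then x $ q else 0)" for i j
    by simp
  also have "\<dots> i j = (\<Sum>q\<in>UNIV. x $ q * unit_op q $ i $ j)" for i j
    by (intro sum.cong refl) (simp add: unit_op_def)
  finally show ?thesis by (simp add: vec_eq_iff)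
qed

lemma block_det_neq_0_iff:
  fixes H :: "'s::finite op"
  shows "block_det \<Psi> H M D \<noteq> 0 \<longleftrightarrow> (\<forall>X. block_gen \<Psi> H M D X = 0 \<longrightarrow> X = 0)"
proof -
  define A :: "complex^('s \<times> 's)^('s \<times> 's)"
    where "A = (\<chi> p q. block_gen \<Psi> H M D (unit_op q) $ fst p $ snd p)"
  have A: "(A *v x) $ (i, j) = block_gen \<Psi> H M D (\<chi> i j. x $ (i, j)) $ i $ j" for x i j
    unfolding op_eq_sum_unit_op block_gen_sum block_gen_cscale
    by (simp add: A_def matrix_vector_mult_def mult.commute)
  have "block_det \<Psi> H M D \<noteq> 0 \<longleftrightarrow> (\<forall>x. A *v x = 0 \<longrightarrow> x = 0)"
    by (simp add: block_det_def A_def[symmetric] invertible_det_nz[symmetric]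
        invertible_left_inverse matrix_left_invertible_ker)
  also have "\<dots> \<longleftrightarrow> (\<forall>X. block_gen \<Psi> H M D X = 0 \<longrightarrow> X = 0)"
  proof (intro iffI allI impI)
    fix X assume inj: "\<forall>x. A *v x = 0 \<longrightarrow> x = 0" and X: "block_gen \<Psi> H M D X = 0"
    have "(\<chi> i j. (\<chi> p. X $ fst p $ snd p) $ (i, j)) = X" by (simp add: vec_eq_iff)
    then have "A *v (\<chi> p. X $ fst p $ snd p) = 0"
      using A[of "\<chi> p. X $ fst p $ snd p"] X by (simp add: vec_eq_iff[of "A *v _"] split_paired_all)
    with inj have "(\<chi> p. X $ fst p $ snd p) = 0" by blast
    then show "X = 0" by (auto simp: vec_eq_iff)
  next
    fix x assume inj: "\<forall>X. block_gen \<Psi> H M D X = 0 \<longrightarrow> X = 0" and x: "A *v x = 0"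
    have "block_gen \<Psi> H M D (\<chi> i j. x $ (i, j)) = 0"
      unfolding vec_eq_iff A[symmetric] x by simp
    with inj have "(\<chi> i j. x $ (i, j)) = 0" by blast
    then show "x = 0" by (auto simp: vec_eq_iff)
  qed
  finally show ?thesis .
qed

lemma complex_polynomial_function_block_det:
  assumes "op_polynomial_function H" "\<And>k. op_polynomial_function (\<lambda>x. D x k)"
  shows "complex_polynomial_function (\<lambda>x. block_det \<Psi> (H x) M (D x))"
  unfolding block_det_def
  using op_polynomial_function_block_gen[OF assms]
  by (intro complex_polynomial_function_det) (simp add: op_polynomial_function_def)

lemma linear_Hpar: "linear (Hpar isH gen)"
  unfolding Hpar_def by (intro linearI) (simp_all add: scaleR_left.add sum.distrib scaleR_sum_right)

lemma linear_Dpar: "linear (\<lambda>x. Dpar isH blk gen x k)"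
  unfolding Dpar_def by (intro linearI) (simp_all add: scaleR_left.add sum.distrib scaleR_sum_right)

lemma hermitian_Hpar:
  assumes "\<And>p. isH p \<Longrightarrow> hermitian (gen p)"
  shows "hermitian (Hpar isH gen x)"
  using assms by (simp add: hermitian_def Hpar_def adj_sum adj_scaleR)

lemma real_basis_family_mem: "real_basis_family g P S \<Longrightarrow> p \<in> P \<Longrightarrow> g p \<in> S"
  unfolding real_basis_family_def by (metis imageI span_base)

theorem theorem2:
  fixes n :: nat and d :: "nat \<Rightarrow> nat" and cf :: "'s::finite \<Rightarrow> nat \<Rightarrow> nat"
    and M :: nat and N :: "nat \<Rightarrow> nat set"
    and \<Psi> :: "complex^'s"
    and blk :: "'p::finite \<Rightarrow> nat" and isH :: "'p \<Rightarrow> bool" and gen :: "'p \<Rightarrow> 's op"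
    and \<gamma> :: real
  assumes tb: "tensor_basis n d cf"
    and nbhd: "\<And>k. k < M \<Longrightarrow> N k \<subset> {0..<n}"
    and unit: "norm \<Psi> = 1"
    and blk_lt: "\<And>p. blk p < M"
    and tau_basis: "\<And>k. k < M \<Longrightarrow>
          real_basis_family gen {p. isH p \<and> blk p = k} {A. hermitian A \<and> local_op n cf (N k) A}"
    and sigma_basis: "\<And>k. k < M \<Longrightarrow>
          real_basis_family gen {p. \<not> isH p \<and> blk p = k} {A. local_op n cf (N k) A}"
    and gamma_pos: "\<gamma> > 0"
  defines "V \<equiv> {x::real^'p. Hpar isH gen x *v \<Psi> = 0 \<and> (\<forall>k<M. Dpar isH blk gen x k *v \<Psi> = 0)}"
    and "C \<equiv> {x::real^'p. \<forall>p. \<bar>x $ p\<bar> \<le> \<gamma>}"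
  assumes ex_gas: "\<exists>x\<in>V. GAS (lindblad (Hpar isH gen x) M (Dpar isH blk gen x)) (proj \<Psi>)"
  shows "\<forall>\<phi> :: real^'d::finite \<Rightarrow> real^'p. linear \<phi> \<and> inj \<phi> \<and> range \<phi> = V \<longrightarrow>
           \<phi> -` {x \<in> V \<inter> C. \<not> GAS (lindblad (Hpar isH gen x) M (Dpar isH blk gen x)) (proj \<Psi>)} \<in> null_sets lborel"
proof (intro allI impI, elim conjE)
  fix \<phi> :: "real^'d \<Rightarrow> real^'p"
  assume \<phi>: "linear \<phi>" and range: "range \<phi> = V"
  \<comment> \<open>The squared modulus is a real polynomial with the same zeros as the complex
    determinant.\<close>
  define f where "f u = (cmod (block_det \<Psi> (Hpar isH gen (\<phi> u)) M (Dpar isH blk gen (\<phi> u))))\<^sup>2" for u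
  have herm: "hermitian (gen p)" if "isH p" for p
    using real_basis_family_mem[OF tau_basis[OF blk_lt[of p]]] that by simp
  have gas_iff: "GAS (lindblad (Hpar isH gen (\<phi> u)) M (Dpar isH blk gen (\<phi> u))) (proj \<Psi>) \<longleftrightarrow> f u \<noteq> 0" for u
  proof -
    have "\<phi> u \<in> V" using range by blast
    then have "invariant_pure_state \<Psi> (Hpar isH gen (\<phi> u)) M (Dpar isH blk gen (\<phi> u))"
      by unfold_locales (simp_all add: V_def unit hermitian_Hpar herm)
    then show ?thesis
      by (simp add: f_def block_det_neq_0_iff invariant_pure_state.GAS_iff_inj_block_gen)
  qed
  have "real_polynomial_function f"
    unfolding f_def
    by (intro real_polynomial_function_cmod_power2 complex_polynomial_function_block_det
        op_polynomial_function_linear linear_compose[OF \<phi> linear_Hpar, unfolded o_def]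
        linear_compose[OF \<phi> linear_Dpar, unfolded o_def])
  \<comment> \<open>The assumed attractive parameter keeps the polynomial from vanishing
    identically.\<close>
  moreover obtain u0 where "f u0 \<noteq> 0"
    using ex_gas range gas_iff by (metis imageE)
  ultimately have null: "{u. f u = 0} \<in> null_sets lborel"
    by (rule null_sets_zeros_real_polynomial_function)
  \<comment> \<open>\<open>lborel\<close> is not complete, so a subset of a null set must also be
    shown to be Borel.\<close>
  have "closed (\<phi> -` C)"
  proof (rule continuous_closed_vimage)
    have "C = (\<Inter>p. {x. \<bar>x $ p\<bar> \<le> \<gamma>})" by (auto simp: C_def)
    then show "closed C" by (auto intro!: closed_INT closed_Collect_le continuous_intros)
    show "isCont \<phi> u" for u by (rule linear_continuous_at[OF linear_conv_bounded_linear[THEN iffD1, OF \<phi>]])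
  qed
  then have "\<phi> -` C \<inter> {u. f u = 0} \<in> null_sets lborel"
    using null by (intro null_set_Int1) auto
  moreover have "\<phi> -` {x \<in> V \<inter> C. \<not> GAS (lindblad (Hpar isH gen x) M (Dpar isH blk gen x)) (proj \<Psi>)}
      = \<phi> -` C \<inter> {u. f u = 0}"
    using range gas_iff by auto
  ultimately show "\<phi> -` {x \<in> V \<inter> C. \<not> GAS (lindblad (Hpar isH gen x) M (Dpar isH blk gen x)) (proj \<Psi>)}
      \<in> null_sets lborel"
    by simp
qed

end
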